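(* For every positive integer $n$ the dihedral group $D_{2n}$ of order $2n$ has difference characteristic satisfying $$\sqrt{2}\le \eth[D_{2n}]\le \frac{48}{\sqrt{586}}.$$ Moreover, if $n\ge 2\cdot 10^{15}$, then $\eth[D_{2n}]<\frac{4}{\sqrt{6}}$.
   Context: A subset $B$ of a group $G$ is a difference basis of $G$ if every $g\in G$ can be written as $g=ab^{-1}$ with $a,b\in B$. For a finite group $G$, the difference size $\Delta[G]$ is the smallest cardinality of a difference basis of $G$, and the difference characteristic is $\eth[G]=\Delta[G]/\sqrt{|G|}$. For a positive integer $n$, $D_{2n}$ denotes the dihedral group of order $2n$, i.e. $D_{2n}=\langle r,s\mid r^n=s^2=1,\ srs^{-1}=r^{-1}\rangle$ (so $D_2$ is the group of order $2$ and $D_4$ is the Klein four-group). *)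

theory Defs
  imports Complex_Main "HOL-Algebra.Generated_Groups"
begin

definition difference_basis :: "('a, 'b) monoid_scheme \<Rightarrow> 'a set \<Rightarrow> bool" where
  "difference_basis G B \<longleftrightarrow>
     B \<subseteq> carrier G \<and>
     (\<forall>g\<in>carrier G. \<exists>a\<in>B. \<exists>b\<in>B. g = a \<otimes>\<^bsub>G\<^esub> inv\<^bsub>G\<^esub> b)"

(* Meaningful for finite groups only; there the carrier itself is a difference basis,
   so the least element exists. *)
definition difference_size :: "('a, 'b) monoid_scheme \<Rightarrow> nat" where
  "difference_size G = (LEAST k. \<exists>B. difference_basis G B \<and> finite B \<and> card B = k)"

definition difference_char :: "('a, 'b) monoid_scheme \<Rightarrow> real" where
  "difference_char G = real (difference_size G) / sqrt (real (order G))"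

(* For n \<ge> 1, the group with presentation <r, s | r^n = s^2 = 1, s r s^-1 = r^-1>,
   realised on normal forms: (k, e) stands for r^k if \<not> e and for r^k s if e.
   The lemmas below show that this is a group of order 2n with the universal property
   of the presentation. For n = 0 the carrier is empty. *)
definition dihedral_group :: "nat \<Rightarrow> (int \<times> bool) monoid" where
  "dihedral_group n =
     \<lparr>carrier = {0..<int n} \<times> UNIV,
      monoid.mult = (\<lambda>(k, e) (l, f). ((if e then k - l else k + l) mod int n, e \<noteq> f)),
      one = (0, False)\<rparr>"

(* The reduction mod n matters only for n = 1, where r is the identity. *)
definition dihedral_r :: "nat \<Rightarrow> int \<times> bool" where
  "dihedral_r n = (1 mod int n, False)"

definition dihedral_s :: "int \<times> bool" where
  "dihedral_s = (0, True)"

lemma carrier_dihedral_group: "carrier (dihedral_group n) = {0..<int n} \<times> UNIV"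
  by (simp add: dihedral_group_def)

lemma one_dihedral_group: "\<one>\<^bsub>dihedral_group n\<^esub> = (0, False)"
  by (simp add: dihedral_group_def)

lemma mult_dihedral_group:
  "(k, e) \<otimes>\<^bsub>dihedral_group n\<^esub> (l, f) = ((if e then k - l else k + l) mod int n, e \<noteq> f)"
  by (simp add: dihedral_group_def)

lemma group_dihedral_group:
  assumes "n > 0"
  shows "group (dihedral_group n)"
proof (rule groupI)
  fix x assume x: "x \<in> carrier (dihedral_group n)"
  obtain k e where [simp]: "x = (k, e)" by (cases x)
  show "\<exists>y\<in>carrier (dihedral_group n). y \<otimes>\<^bsub>dihedral_group n\<^esub> x = \<one>\<^bsub>dihedral_group n\<^esub>"
  proof (rule bexI)
    show "(if e then k else (- k) mod int n, e) \<otimes>\<^bsub>dihedral_group n\<^esub> x = \<one>\<^bsub>dihedral_group n\<^esub>"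
      by (simp add: mult_dihedral_group one_dihedral_group mod_simps)
    show "(if e then k else (- k) mod int n, e) \<in> carrier (dihedral_group n)"
      using x assms by (auto simp: carrier_dihedral_group)
  qed
qed (use assms in \<open>auto simp: carrier_dihedral_group mult_dihedral_group
       one_dihedral_group mod_simps algebra_simps\<close>)

lemma order_dihedral_group: "order (dihedral_group n) = 2 * n"
  by (simp add: order_def carrier_dihedral_group card_cartesian_product)

lemma dihedral_r_closed: "n > 0 \<Longrightarrow> dihedral_r n \<in> carrier (dihedral_group n)"
  by (simp add: dihedral_r_def carrier_dihedral_group)

lemma dihedral_s_closed: "n > 0 \<Longrightarrow> dihedral_s \<in> carrier (dihedral_group n)"
  by (simp add: dihedral_s_def carrier_dihedral_group)

lemma dihedral_r_pow:
  "dihedral_r n [^]\<^bsub>dihedral_group n\<^esub> (m::nat) = (int m mod int n, False)"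
  by (induction m)
     (auto simp: one_dihedral_group dihedral_r_def mult_dihedral_group mod_simps add.commute)

lemma dihedral_normal_form:
  assumes "0 \<le> k" "k < int n"
  shows "(k, e) = dihedral_r n [^]\<^bsub>dihedral_group n\<^esub> nat k
           \<otimes>\<^bsub>dihedral_group n\<^esub> (if e then dihedral_s else \<one>\<^bsub>dihedral_group n\<^esub>)"
  using assms by (simp add: dihedral_r_pow dihedral_s_def one_dihedral_group mult_dihedral_group)

lemma dihedral_relations:
  assumes "n > 0"
  defines "D \<equiv> dihedral_group n"
  shows "dihedral_r n [^]\<^bsub>D\<^esub> n = \<one>\<^bsub>D\<^esub>"
    and "dihedral_s [^]\<^bsub>D\<^esub> (2::nat) = \<one>\<^bsub>D\<^esub>"
    and "dihedral_s \<otimes>\<^bsub>D\<^esub> dihedral_r n \<otimes>\<^bsub>D\<^esub> inv\<^bsub>D\<^esub> dihedral_s = inv\<^bsub>D\<^esub> dihedral_r n"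
proof -
  interpret D: group D unfolding D_def by (rule group_dihedral_group[OF assms(1)])
  have r: "dihedral_r n \<in> carrier D" and s: "dihedral_s \<in> carrier D"
    using assms by (simp_all add: dihedral_r_closed dihedral_s_closed)
  show "dihedral_r n [^]\<^bsub>D\<^esub> n = \<one>\<^bsub>D\<^esub>"
    by (simp add: D_def dihedral_r_pow one_dihedral_group)
  have ss: "dihedral_s \<otimes>\<^bsub>D\<^esub> dihedral_s = \<one>\<^bsub>D\<^esub>"
    by (simp add: D_def dihedral_s_def mult_dihedral_group one_dihedral_group)
  then show "dihedral_s [^]\<^bsub>D\<^esub> (2::nat) = \<one>\<^bsub>D\<^esub>"
    using s by (simp add: numeral_2_eq_2)
  have inv_s: "inv\<^bsub>D\<^esub> dihedral_s = dihedral_s"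
    using ss s by (simp add: D.inv_equality)
  have "(dihedral_s \<otimes>\<^bsub>D\<^esub> dihedral_r n \<otimes>\<^bsub>D\<^esub> dihedral_s) \<otimes>\<^bsub>D\<^esub> dihedral_r n = \<one>\<^bsub>D\<^esub>"
    by (simp add: D_def dihedral_s_def dihedral_r_def mult_dihedral_group one_dihedral_group mod_simps)
  then show "dihedral_s \<otimes>\<^bsub>D\<^esub> dihedral_r n \<otimes>\<^bsub>D\<^esub> inv\<^bsub>D\<^esub> dihedral_s = inv\<^bsub>D\<^esub> dihedral_r n"
    using r s by (simp add: inv_s D.inv_equality)
qed

lemma dihedral_generate:
  assumes "n > 0"
  shows "generate (dihedral_group n) {dihedral_r n, dihedral_s} = carrier (dihedral_group n)"
proof -
  interpret D: group "dihedral_group n" by (rule group_dihedral_group[OF assms])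
  let ?S = "{dihedral_r n, dihedral_s}"
  have "dihedral_r n [^]\<^bsub>dihedral_group n\<^esub> m \<in> generate (dihedral_group n) ?S" for m :: nat
    by (induction m) (auto intro: generate.intros)
  then have "(k, e) \<in> generate (dihedral_group n) ?S" if "0 \<le> k" "k < int n" for k e
    unfolding dihedral_normal_form[OF that] by (auto intro: generate.intros)
  moreover have "generate (dihedral_group n) ?S \<subseteq> carrier (dihedral_group n)"
    using assms by (intro D.generate_incl) (auto simp: dihedral_r_closed dihedral_s_closed)
  ultimately show ?thesis
    by (auto simp: carrier_dihedral_group)
qed

lemma dihedral_universal_property:
  assumes n: "n > 0" and G: "group G" and a: "a \<in> carrier G" and b: "b \<in> carrier G"
    and an: "a [^]\<^bsub>G\<^esub> n = \<one>\<^bsub>G\<^esub>" and b2: "b [^]\<^bsub>G\<^esub> (2::nat) = \<one>\<^bsub>G\<^esub>"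
    and ba: "b \<otimes>\<^bsub>G\<^esub> a \<otimes>\<^bsub>G\<^esub> inv\<^bsub>G\<^esub> b = inv\<^bsub>G\<^esub> a"
  shows "\<exists>h\<in>hom (dihedral_group n) G. h (dihedral_r n) = a \<and> h dihedral_s = b \<and>
           (\<forall>h'\<in>hom (dihedral_group n) G. h' (dihedral_r n) = a \<longrightarrow> h' dihedral_s = b \<longrightarrow>
              (\<forall>x\<in>carrier (dihedral_group n). h' x = h x))"
proof -
  interpret G: group G by (rule G)
  interpret D: group "dihedral_group n" by (rule group_dihedral_group[OF n])
  let ?D = "dihedral_group n"
  let ?p = "\<lambda>k::int. a [^]\<^bsub>G\<^esub> k"
  let ?q = "\<lambda>e. if e then b else \<one>\<^bsub>G\<^esub>"
  define h where "h = (\<lambda>(k, e). ?p k \<otimes>\<^bsub>G\<^esub> ?q e)"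
  have pmod: "?p (k mod int n) = ?p k" for k
  proof -
    have "?p k = ?p (int n * (k div int n) + k mod int n)" by simp
    also have "\<dots> = ?p (int n) [^]\<^bsub>G\<^esub> (k div int n) \<otimes>\<^bsub>G\<^esub> ?p (k mod int n)"
      using a by (simp only: G.int_pow_mult G.int_pow_pow)
    also have "\<dots> = ?p (k mod int n)"
      using a an by (simp add: int_pow_int)
    finally show ?thesis by simp
  qed
  have bb: "b \<otimes>\<^bsub>G\<^esub> b = \<one>\<^bsub>G\<^esub>"
    using b2 b by (simp add: numeral_2_eq_2)
  have ba': "b \<otimes>\<^bsub>G\<^esub> a = inv\<^bsub>G\<^esub> a \<otimes>\<^bsub>G\<^esub> b"
    using ba a b by (metis G.inv_solve_right G.inv_closed G.m_closed)
  have bpn: "b \<otimes>\<^bsub>G\<^esub> a [^]\<^bsub>G\<^esub> m = (inv\<^bsub>G\<^esub> a) [^]\<^bsub>G\<^esub> m \<otimes>\<^bsub>G\<^esub> b" for m :: nat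
  proof (induction m)
    case (Suc m)
    have "b \<otimes>\<^bsub>G\<^esub> a [^]\<^bsub>G\<^esub> Suc m = (b \<otimes>\<^bsub>G\<^esub> a [^]\<^bsub>G\<^esub> m) \<otimes>\<^bsub>G\<^esub> a"
      using a b by (simp add: G.m_assoc)
    also have "\<dots> = (inv\<^bsub>G\<^esub> a) [^]\<^bsub>G\<^esub> m \<otimes>\<^bsub>G\<^esub> (b \<otimes>\<^bsub>G\<^esub> a)"
      using a b by (simp add: Suc G.m_assoc)
    also have "\<dots> = (inv\<^bsub>G\<^esub> a) [^]\<^bsub>G\<^esub> Suc m \<otimes>\<^bsub>G\<^esub> b"
      using a b by (simp add: ba' G.m_assoc)
    finally show ?case .
  qed (use b in simp)
  have bp: "b \<otimes>\<^bsub>G\<^esub> ?p l = ?p (- l) \<otimes>\<^bsub>G\<^esub> b" if "0 \<le> l" for l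
    using bpn[of "nat l"] a that
    by (simp add: G.int_pow_neg G.int_pow_inv flip: int_pow_int G.int_pow_inv)
  have hom: "h \<in> hom ?D G"
  proof (rule homI)
    show "h x \<in> carrier G" for x
      using a b by (cases x) (simp add: h_def)
    fix x y assume "x \<in> carrier ?D" and y: "y \<in> carrier ?D"
    obtain k e l f where xy: "x = (k, e)" "y = (l, f)" by (cases x, cases y)
    have l: "0 \<le> l" using y by (simp add: xy carrier_dihedral_group)
    show "h (x \<otimes>\<^bsub>?D\<^esub> y) = h x \<otimes>\<^bsub>G\<^esub> h y"
    proof (cases e)
      case True
      have "h x \<otimes>\<^bsub>G\<^esub> h y = ?p k \<otimes>\<^bsub>G\<^esub> (b \<otimes>\<^bsub>G\<^esub> ?p l) \<otimes>\<^bsub>G\<^esub> ?q f"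
        using a b True by (simp add: h_def xy G.m_assoc)
      also have "\<dots> = ?p (k - l) \<otimes>\<^bsub>G\<^esub> (b \<otimes>\<^bsub>G\<^esub> ?q f)"
        using a b by (simp add: bp[OF l] G.m_assoc G.int_pow_diff G.int_pow_neg)
      also have "b \<otimes>\<^bsub>G\<^esub> ?q f = ?q (e \<noteq> f)"
        using True b bb by simp
      finally show ?thesis
        using True by (simp add: h_def xy mult_dihedral_group pmod)
    next
      case False
      then show ?thesis
        using a b by (simp add: h_def xy mult_dihedral_group pmod G.int_pow_mult G.m_assoc)
    qed
  qed
  have unique: "h' x = h x"
    if h': "h' \<in> hom ?D G" "h' (dihedral_r n) = a" "h' dihedral_s = b" and x: "x \<in> carrier ?D"
    for h' x
  proof -
    interpret H: group_hom ?D G h' by unfold_locales (rule h'(1))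
    obtain k e where xk: "x = (k, e)" "0 \<le> k" "k < int n"
      using x by (cases x) (auto simp: carrier_dihedral_group)
    have "h' x = h' (dihedral_r n [^]\<^bsub>?D\<^esub> nat k \<otimes>\<^bsub>?D\<^esub> (if e then dihedral_s else \<one>\<^bsub>?D\<^esub>))"
      using dihedral_normal_form[OF xk(2,3)] xk(1) by simp
    also have "\<dots> = a [^]\<^bsub>G\<^esub> nat k \<otimes>\<^bsub>G\<^esub> ?q e"
      using h' n by (simp add: dihedral_r_closed dihedral_s_closed H.hom_nat_pow)
    also have "\<dots> = h x"
      using xk by (simp add: h_def flip: int_pow_int)
    finally show ?thesis .
  qed
  have "h (dihedral_r n) = a" "h dihedral_s = b"
    using a b by (simp_all add: h_def dihedral_r_def dihedral_s_def pmod)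
  with hom unique show ?thesis by blast
qed

end

theory Submission
  imports Defs
begin

text \<open>
  A difference basis of the dihedral group consists of rotations with exponents in \<open>A\<close> and
  reflections with exponents in \<open>C\<close>. It has to satisfy \<open>A + C = \<int>/n\<close>, which gives
  \<open>n \<le> |A| |C|\<close> and hence the lower bound, and \<open>(A - A) \<union> (C - C) = \<int>/n\<close>.

  For all \<open>n\<close>, take an interval of length \<open>a\<close> together with a comb of step \<open>a\<close> up to \<open>n/2\<close>
  for \<open>A\<close>, and the multiples of \<open>a\<close> for \<open>C\<close>; then \<open>|A| + |C|\<close> is about
  \<open>a + 3n/(2a)\<close>, that is \<open>sqrt (6 n)\<close> for the best \<open>a\<close>.

  For large \<open>n\<close>, view \<open>\<int>/n\<close> as a torus via \<open>(x, y) \<mapsto> x + a y\<close>. Arithmetic progressions with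
  steps \<open>1\<close>, \<open>a\<close> and \<open>a + 1\<close> become segments in the directions \<open>(1, 0)\<close>, \<open>(0, 1)\<close> and
  \<open>(1, 1)\<close>. Any two of these directions have determinant \<open>\<plusminus>1\<close>, so that the sum (or
  difference) of two such segments fills a rhombus without gaps. In units of a length \<open>l\<close>, nine
  unit segments suffice to cover a torus of area 16 by the sums and also by the differences, so
  that \<open>|A| + |C|\<close> is about \<open>9 l = (9/4) sqrt n\<close>, which is less than \<open>(4 / sqrt 3) sqrt n\<close>.
  The torus has to fit \<open>n\<close> only up to an error of order \<open>sqrt l\<close>, which is absorbed by prolonging
  the segments.
\<close>

section \<open>Difference bases of dihedral groups and the lower bound\<close>

lemma inv_dihedral_group:
  assumes "n > 0" "(k, e) \<in> carrier (dihedral_group n)"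
  shows "inv\<^bsub>dihedral_group n\<^esub> (k, e) = ((if e then k else - k) mod int n, e)"
proof -
  interpret group "dihedral_group n" by (rule group_dihedral_group[OF assms(1)])
  show ?thesis
    by (rule inv_equality)
      (use assms in \<open>auto simp: mult_dihedral_group one_dihedral_group carrier_dihedral_group mod_simps\<close>)
qed

lemma difference_basis_carrier:
  assumes "group G"
  shows "difference_basis G (carrier G)"
proof -
  interpret group G by (rule assms)
  show ?thesis
    unfolding difference_basis_def
    by (intro conjI ballI bexI[of _ "\<one>\<^bsub>G\<^esub>"] bexI) auto
qed

lemma difference_size_attained:
  assumes "group G" "finite (carrier G)"
  shows "\<exists>B. difference_basis G B \<and> finite B \<and> card B = difference_size G"
  unfolding difference_size_def
  by (rule LeastI_ex) (use difference_basis_carrier assms in blast)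

lemma difference_size_le:
  assumes "difference_basis G B" "finite B"
  shows "difference_size G \<le> card B"
  unfolding difference_size_def by (rule Least_le) (use assms in auto)

text \<open>A reflection is only a quotient of a rotation and a reflection, and in either order the
  exponents add up. So the sums from \<open>R \<times> S\<close> fill all residues, and the
  inequality of arithmetic and geometric means applies.\<close>

lemma dihedral_basis_card:
  assumes "n > 0" and B: "difference_basis (dihedral_group n) B" "finite B"
  shows "4 * n \<le> card B ^ 2"
proof -
  define R where "R = {k. (k, False) \<in> B}"
  define S where "S = {k. (k, True) \<in> B}"
  have BRS: "B = (\<lambda>k. (k, False)) ` R \<union> (\<lambda>k. (k, True)) ` S"
    unfolding R_def S_def by (auto simp: image_iff) (metis (full_types))
  have "R \<subseteq> fst ` B" "S \<subseteq> fst ` B"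
    by (force simp: R_def S_def)+
  then have fin: "finite R" "finite S"
    using B(2) finite_subset by blast+
  have card: "card B = card R + card S"
    unfolding BRS by (subst card_Un_disjoint) (auto simp: fin card_image inj_on_def)
  have sub: "B \<subseteq> carrier (dihedral_group n)"
    using B by (simp add: difference_basis_def)
  have "{0..<int n} \<subseteq> (\<lambda>(k, l). (k + l) mod int n) ` (R \<times> S)"
  proof
    fix z assume "z \<in> {0..<int n}"
    then have "(z, True) \<in> carrier (dihedral_group n)"
      by (simp add: carrier_dihedral_group)
    then obtain k e l f where kl: "(k, e) \<in> B" "(l, f) \<in> B"
      and z: "(z, True) = (k, e) \<otimes>\<^bsub>dihedral_group n\<^esub> inv\<^bsub>dihedral_group n\<^esub> (l, f)"
      using B unfolding difference_basis_def by (metis surj_pair)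
    from kl have c: "(l, f) \<in> carrier (dihedral_group n)"
      using sub by blast
    have ef: "e \<noteq> f" and zkl: "z = (k + l) mod int n"
      using z by (auto simp: inv_dihedral_group[OF assms(1) c] mult_dihedral_group mod_simps
          split: if_splits)
    have "(k, l) \<in> R \<times> S \<or> (l, k) \<in> R \<times> S"
      using kl ef by (cases e) (auto simp: R_def S_def)
    then show "z \<in> (\<lambda>(k, l). (k + l) mod int n) ` (R \<times> S)"
    proof
      assume "(k, l) \<in> R \<times> S"
      with zkl show ?thesis by force
    next
      assume "(l, k) \<in> R \<times> S"
      moreover have "z = (l + k) mod int n" using zkl by (simp add: add.commute)
      ultimately show ?thesis by force
    qed
  qed
  then have "card {0..<int n} \<le> card (R \<times> S)"
    by (meson fin finite_SigmaI surj_card_le)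
  then have "n \<le> card R * card S"
    by (simp add: card_cartesian_product)
  moreover have "4 * (card R * card S) \<le> (card R + card S)\<^sup>2"
  proof -
    have "0 \<le> (int (card R) - int (card S))\<^sup>2" by simp
    then have "int (4 * (card R * card S)) \<le> int ((card R + card S)\<^sup>2)"
      by (simp add: power2_eq_square algebra_simps)
    then show ?thesis by linarith
  qed
  ultimately show ?thesis
    unfolding card by linarith
qed

text \<open>\<open>A\<close> holds rotations and \<open>C\<close> reflections: mixed quotients give
  sums, the others give differences. Swapping \<open>a\<close> and \<open>b\<close> negates a
  difference, so half of the residues suffice.\<close>

lemma difference_size_dihedral_le:
  fixes A C :: "int set"
  assumes n: "n > 0" and fin: "finite A" "finite C"
    and sums: "\<And>z. 0 \<le> z \<Longrightarrow> z < int n \<Longrightarrow> \<exists>a\<in>A. \<exists>c\<in>C. (a + c) mod int n = z"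
    and diffs: "\<And>d. 0 \<le> d \<Longrightarrow> 2 * d \<le> int n \<Longrightarrow>
      (\<exists>a\<in>A. \<exists>b\<in>A. (a - b) mod int n = d) \<or> (\<exists>a\<in>C. \<exists>b\<in>C. (a - b) mod int n = d)"
  shows "difference_size (dihedral_group n) \<le> card A + card C"
proof -
  let ?D = "dihedral_group n"
  define R where "R = (\<lambda>a. (a mod int n, False)) ` A"
  define S where "S = (\<lambda>c. (c mod int n, True)) ` C"
  have sub: "R \<union> S \<subseteq> carrier ?D"
    using n by (auto simp: R_def S_def carrier_dihedral_group)
  have all: "\<exists>x\<in>R \<union> S. \<exists>y\<in>R \<union> S. (z, e) = x \<otimes>\<^bsub>?D\<^esub> inv\<^bsub>?D\<^esub> y"
    if z: "0 \<le> z" "z < int n" for z e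
  proof (cases e)
    case True
    obtain a c where "a \<in> A" "c \<in> C" and ac: "(a + c) mod int n = z"
      using sums[OF z] by blast
    then have mem: "(a mod int n, False) \<in> R" "(c mod int n, True) \<in> S"
      by (auto simp: R_def S_def)
    have "(z, e) = (a mod int n, False) \<otimes>\<^bsub>?D\<^esub> inv\<^bsub>?D\<^esub> (c mod int n, True)"
      using n sub mem ac True
      by (subst inv_dihedral_group) (auto simp: mult_dihedral_group mod_simps)
    with mem show ?thesis by blast
  next
    case False
    obtain a b where zab: "z = (a - b) mod int n"
      and mem: "a \<in> A \<and> b \<in> A \<or> a \<in> C \<and> b \<in> C"
    proof (cases "2 * z \<le> int n")
      case True
      with diffs[OF z(1)] that show ?thesis by blast
    next
      case nle: False
      have "0 \<le> int n - z" "2 * (int n - z) \<le> int n"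
        using z nle by auto
      from diffs[OF this] obtain a b where ab: "(a - b) mod int n = int n - z"
        and mem: "a \<in> A \<and> b \<in> A \<or> a \<in> C \<and> b \<in> C" by blast
      have "(b - a) mod int n = (- ((a - b) mod int n)) mod int n"
        by (simp add: mod_simps)
      also have "\<dots> = z" using z ab by simp
      finally show ?thesis using that mem by metis
    qed
    from mem show ?thesis
    proof
      assume m: "a \<in> A \<and> b \<in> A"
      then have mem: "(a mod int n, False) \<in> R" "(b mod int n, False) \<in> R"
        by (auto simp: R_def)
      have "(z, e) = (a mod int n, False) \<otimes>\<^bsub>?D\<^esub> inv\<^bsub>?D\<^esub> (b mod int n, False)"
        using n sub mem zab False
        by (subst inv_dihedral_group) (auto simp: mult_dihedral_group mod_simps)
      with mem show ?thesis by blast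
    next
      assume m: "a \<in> C \<and> b \<in> C"
      then have mem: "(a mod int n, True) \<in> S" "(b mod int n, True) \<in> S"
        by (auto simp: S_def)
      have "(z, e) = (a mod int n, True) \<otimes>\<^bsub>?D\<^esub> inv\<^bsub>?D\<^esub> (b mod int n, True)"
        using n sub mem zab False
        by (subst inv_dihedral_group) (auto simp: mult_dihedral_group mod_simps)
      with mem show ?thesis by blast
    qed
  qed
  have "difference_basis ?D (R \<union> S)"
    unfolding difference_basis_def
  proof (intro conjI ballI sub)
    fix g assume "g \<in> carrier ?D"
    then obtain z e where "g = (z, e)" "0 \<le> z" "z < int n"
      by (cases g) (auto simp: carrier_dihedral_group)
    with all show "\<exists>x\<in>R \<union> S. \<exists>y\<in>R \<union> S. g = x \<otimes>\<^bsub>?D\<^esub> inv\<^bsub>?D\<^esub> y"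
      by blast
  qed
  then have "difference_size ?D \<le> card (R \<union> S)"
    by (rule difference_size_le) (simp add: R_def S_def fin)
  also have "\<dots> \<le> card R + card S"
    by (rule card_Un_le)
  also have "\<dots> \<le> card A + card C"
    unfolding R_def S_def by (intro add_mono card_image_le fin)
  finally show ?thesis .
qed

section \<open>The comb construction\<close>

lemma difference_size_dihedral_comb:
  assumes n: "n > 0" and a: "a > 0"
  shows "difference_size (dihedral_group n) \<le> a + n div 2 div a + (n + a - 1) div a"
proof -
  \<comment> \<open>Each tooth is the last element of a block of length \<open>a\<close>, so
    subtracting the interval reaches the whole block. The tooth for \<open>j = 0\<close> is
    \<open>a - 1\<close>, already in the interval.\<close>
  define A where "A = {0..<int a} \<union> (\<lambda>j. int a * (j + 1) - 1) ` {1..int (n div 2 div a)}"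
  define C where "C = (\<lambda>j. int a * j) ` {0..<int ((n + a - 1) div a)}"
  have "difference_size (dihedral_group n) \<le> card A + card C"
  proof (rule difference_size_dihedral_le[OF n])
    show "finite A" "finite C" by (simp_all add: A_def C_def)
  next
    fix z assume z: "0 \<le> z" "z < int n"
    have "nat z div a < (n + a - 1) div a"
    proof -
      have "nat z + a \<le> n + a - 1" using z by linarith
      then have "(nat z + a) div a \<le> (n + a - 1) div a" by (rule div_le_mono)
      then show ?thesis using a by simp
    qed
    then have "z div int a < int ((n + a - 1) div a)"
      using z by (metis nat_0_le of_nat_less_iff zdiv_int)
    then have "int a * (z div int a) \<in> C"
      using z a by (auto simp: C_def pos_imp_zdiv_nonneg_iff)
    moreover have "z mod int a \<in> A" using a by (simp add: A_def)
    moreover have "(z mod int a + int a * (z div int a)) mod int n = z"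
      using z by simp
    ultimately show "\<exists>a\<in>A. \<exists>c\<in>C. (a + c) mod int n = z" by blast
  next
    fix d assume d: "0 \<le> d" "2 * d \<le> int n"
    define j where "j = d div int a"
    have d_eq: "d = int a * j + d mod int a" by (simp add: j_def)
    have r: "0 \<le> d mod int a" "d mod int a < int a" using a by simp_all
    have "nat d \<le> n div 2" using d by linarith
    then have "nat d div a \<le> n div 2 div a" by (rule div_le_mono)
    then have j: "0 \<le> j" "j \<le> int (n div 2 div a)"
      using d a unfolding j_def
      by (simp_all add: pos_imp_zdiv_nonneg_iff) (metis nat_0_le of_nat_le_iff zdiv_int)
    have "int a * (j + 1) - 1 \<in> A"
    proof (cases "j = 0")
      case False
      then show ?thesis using j by (auto simp: A_def)
    qed (use a in \<open>simp add: A_def\<close>)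
    moreover have "int a - 1 - d mod int a \<in> A" using r by (simp add: A_def)
    moreover have "d = (int a * (j + 1) - 1) - (int a - 1 - d mod int a)"
      using d_eq by (simp add: algebra_simps)
    moreover have "d mod int n = d" using d n by simp
    ultimately show "(\<exists>a\<in>A. \<exists>b\<in>A. (a - b) mod int n = d) \<or>
        (\<exists>a\<in>C. \<exists>b\<in>C. (a - b) mod int n = d)" by metis
  qed
  also have "card A \<le> card {0..<int a} + card ((\<lambda>j. int a * (j + 1) - 1) ` {1..int (n div 2 div a)})"
    unfolding A_def by (rule card_Un_le)
  also have "\<dots> \<le> a + card {1..int (n div 2 div a)}"
    by (intro add_mono card_image_le) auto
  also have "card C \<le> card {0..<int ((n + a - 1) div a)}"
    unfolding C_def by (rule card_image_le) simp
  finally show ?thesis by simp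
qed

section \<open>Covering the torus by rhombi: a finite check\<close>

text \<open>The coordinates with respect to \<open>u\<close> and \<open>v\<close> come from Cramer's
  rule; as the determinant is 1 or -1, multiplying by \<open>D\<close> replaces dividing by
  it.\<close>

definition in_rhombus :: "int \<times> int \<Rightarrow> int \<times> int \<Rightarrow> int \<times> int \<Rightarrow> bool" where
  "in_rhombus u v = (\<lambda>(x, y). case (u, v) of ((u1, u2), (v1, v2)) \<Rightarrow>
     let D = u1 * v2 - u2 * v1 in D * D = 1 \<and>
       D * (x * v2 - y * v1) \<in> {0..1} \<and> D * (u1 * y - u2 * x) \<in> {0..1})"

text \<open>
  In units of \<open>l\<close>, the torus is the plane modulo the lattice generated by \<open>(16, 0)\<close> and
  \<open>(7, 1)\<close>, so that its unit cells are those with lower left corner \<open>(X, 0)\<close>, \<open>X < 16\<close>. Each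
  cell is cut by its diagonal into an upper and a lower triangle; \<open>covers\<close> says that some lattice
  translate of the triangle lies in the rhombus spanned by \<open>u\<close> and \<open>v\<close> at \<open>(P, 0)\<close>.
\<close>

definition covers :: "bool \<Rightarrow> int \<Rightarrow> int \<times> int \<Rightarrow> int \<times> int \<Rightarrow> int \<Rightarrow> bool" where
  "covers up X u v P \<longleftrightarrow>
     list_ex (\<lambda>k. list_ex (\<lambda>l. let x = X + 16 * k + 7 * l - P in
        in_rhombus u v (x, l) \<and> in_rhombus u v (x + 1, l + 1) \<and>
        in_rhombus u v (if up then (x, l + 1) else (x + 1, l))) [-1, 0, 1]) [-1, 0, 1]"

text \<open>
  An edge \<open>(u, P)\<close> is the unit segment in direction \<open>u\<close> starting at \<open>(P, 0)\<close>. The nine edges were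
  found by a computer search.
\<close>

definition edges_A :: "((int \<times> int) \<times> int) list" where
  "edges_A = [((1, 0), 4), ((0, 1), 4), ((1, 0), 12), ((0, 1), 12)]"

definition edges_C :: "((int \<times> int) \<times> int) list" where
  "edges_C = [((1, 1), 3), ((1, 1), 9), ((1, 1), 13), ((0, 1), 7), ((1, 0), 8)]"

definition sum_covers where
  "sum_covers E F up X \<longleftrightarrow> list_ex (\<lambda>(u, P). list_ex (\<lambda>(v, Q). covers up X u v (P + Q)) F) E"

definition diff_covers where
  "diff_covers E up X \<longleftrightarrow>
     list_ex (\<lambda>(u, P). list_ex (\<lambda>((v1, v2), Q). covers up X u (- v1, - v2) (P - Q)) E) E"

lemma sum_covers_edges:
  "list_all (\<lambda>X. sum_covers edges_A edges_C False X \<and> sum_covers edges_A edges_C True X) [0..15]"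
  by code_simp

lemma diff_covers_edges:
  "list_all (\<lambda>X. (diff_covers edges_A False X \<or> diff_covers edges_C False X) \<and>
     (diff_covers edges_A True X \<or> diff_covers edges_C True X)) [0..15]"
  by code_simp

section \<open>From unit cells to residues modulo \<open>n\<close>\<close>

definition small :: "int \<times> int \<Rightarrow> bool" where
  "small u \<longleftrightarrow> \<bar>fst u\<bar> \<le> 1 \<and> \<bar>snd u\<bar> \<le> 1"

text \<open>The weights are nonnegative and add up to \<open>l\<close>: they are \<open>l\<close>
  times the barycentric coordinates of a point in a triangle.\<close>

lemma barycentric_bounds:
  fixes x y l :: int
  assumes "0 \<le> y" "y \<le> x" "x \<le> l" and "g0 \<in> {0..1}" "g1 \<in> {0..1}" "g2 \<in> {0..1}"
  shows "(l - x) * g0 + (x - y) * g1 + y * g2 \<in> {0..l}"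
proof -
  have "g0 = 0 \<or> g0 = 1" "g1 = 0 \<or> g1 = 1" "g2 = 0 \<or> g2 = 1"
    using assms by auto
  then show ?thesis using assms by (elim disjE) simp_all
qed

text \<open>On a triangle scaled by \<open>l\<close>, a linear form is \<open>l\<close> times a
  convex combination of its corner values. So a triangle with its corners in a rhombus stays inside
  after scaling.\<close>

lemma linear_bounds:
  fixes p q x y l X Y :: int
  assumes "0 \<le> x" "x \<le> l" "0 \<le> y" "y \<le> l" and tri: "if up then x \<le> y else y \<le> x"
    and "X * p + Y * q \<in> {0..1}" "(X + 1) * p + (Y + 1) * q \<in> {0..1}"
      "(if up then X * p + (Y + 1) * q else (X + 1) * p + Y * q) \<in> {0..1}"
  shows "(l * X + x) * p + (l * Y + y) * q \<in> {0..l}"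
proof (cases up)
  case True
  have "(l - y) * (X * p + Y * q) + (y - x) * (X * p + (Y + 1) * q)
      + x * ((X + 1) * p + (Y + 1) * q) \<in> {0..l}"
    by (rule barycentric_bounds) (use assms True in simp_all)
  then show ?thesis by (simp add: algebra_simps)
next
  case False
  have "(l - x) * (X * p + Y * q) + (x - y) * ((X + 1) * p + Y * q)
      + y * ((X + 1) * p + (Y + 1) * q) \<in> {0..l}"
    by (rule barycentric_bounds) (use assms False in simp_all)
  then show ?thesis by (simp add: algebra_simps)
qed

text \<open>The scaled triangle lies in the scaled rhombus after a lattice translation, which
  preserves residues only up to small errors. Correcting these moves the rhombus coordinates by at
  most \<open>2 * c + 1\<close>.\<close>

lemma covers_point:
  fixes a \<alpha> \<beta> c l n x y :: int
  assumes cov: "covers up X u v P" and uv: "small u" "small v"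
    and xy: "0 \<le> x" "x \<le> l" "0 \<le> y" "y \<le> l" "if up then x \<le> y else y \<le> x"
    and lattice: "16 * l = a + \<alpha>" "7 * l + a * l = n + \<beta>" "\<bar>\<alpha>\<bar> \<le> c" "\<bar>\<beta>\<bar> \<le> c"
  shows "\<exists>i\<in>{- (2 * c + 1)..l + (2 * c + 1)}. \<exists>j\<in>{- (2 * c + 1)..l + (2 * c + 1)}.
     n dvd (l * X + x + a * y) - (l * P + (fst u + a * snd u) * i + (fst v + a * snd v) * j)"
proof -
  obtain u1 u2 v1 v2 where [simp]: "u = (u1, u2)" "v = (v1, v2)" by (cases u, cases v) auto
  define D where "D = u1 * v2 - u2 * v1"
  obtain k m where km: "k \<in> set [-1, 0, 1]" "m \<in> set [-1, 0, 1]" and rh: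
     "in_rhombus u v (X + 16 * k + 7 * m - P, m)" 
     "in_rhombus u v (X + 16 * k + 7 * m - P + 1, m + 1)"
     "in_rhombus u v (if up then (X + 16 * k + 7 * m - P, m + 1) else (X + 16 * k + 7 * m - P + 1, m))"
    using cov unfolding covers_def list_ex_iff Let_def by blast
  define Z where "Z = X + 16 * k + 7 * m - P"
  note rh = rh[folded Z_def]
  have rhD: "D * D = 1 \<and> p * (D * v2) + q * (- D * v1) \<in> {0..1} \<and> p * (- D * u2) + q * (D * u1) \<in> {0..1}"
    if "in_rhombus u v (p, q)" for p q
  proof -
    have "p * (D * v2) + q * (- D * v1) = D * (p * v2 - q * v1)"
      "p * (- D * u2) + q * (D * u1) = D * (u1 * q - u2 * p)"
      by (simp_all add: algebra_simps)
    with that show ?thesis by (simp add: in_rhombus_def Let_def D_def)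
  qed
  have DD: "D * D = 1" using rhD[OF rh(1)] by blast
  then have D: "D = 1 \<or> D = -1" by (simp add: zmult_eq_1_iff)
  have third:
    "(if up then Z * (D * v2) + (m + 1) * (- D * v1) else (Z + 1) * (D * v2) + m * (- D * v1)) \<in> {0..1}"
    "(if up then Z * (- D * u2) + (m + 1) * (D * u1) else (Z + 1) * (- D * u2) + m * (D * u1)) \<in> {0..1}"
    using rhD[of Z "m + 1"] rhD[of "Z + 1" m] rh(3) by (cases up; simp)+
  have I: "(l * Z + x) * (D * v2) + (l * m + y) * (- D * v1) \<in> {0..l}"
    by (rule linear_bounds[where up = up])
      (use xy rhD[OF rh(1)] rhD[OF rh(2)] third in simp_all)
  have J: "(l * Z + x) * (- D * u2) + (l * m + y) * (D * u1) \<in> {0..l}"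
    by (rule linear_bounds[where up = up])
      (use xy rhD[OF rh(1)] rhD[OF rh(2)] third in simp_all)
  \<comment> \<open>Modulo \<open>n\<close>, the translation by \<open>k\<close> times
    \<open>(16 l, 0)\<close> and \<open>m\<close> times \<open>(7 l, l)\<close> equals the one by
    \<open>(\<delta>, k)\<close>; \<open>i\<close> and \<open>j\<close> below are the rhombus
    coordinates after subtracting it.\<close>
  define \<delta> where "\<delta> = k * \<alpha> + m * \<beta>"
  have d: "\<bar>\<delta>\<bar> \<le> 2 * c" "\<bar>k\<bar> \<le> 1"
    using km lattice(3,4) by (auto simp: \<delta>_def)
  define i where "i = D * ((l * Z + x - \<delta>) * v2 - (l * m + y - k) * v1)"
  define j where "j = D * (u1 * (l * m + y - k) - u2 * (l * Z + x - \<delta>))"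
  have shift: "\<bar>D * (p * \<delta> + q * k)\<bar> \<le> 2 * c + 1" if "\<bar>p\<bar> \<le> 1" "\<bar>q\<bar> \<le> 1" for p q :: int
  proof -
    have "\<bar>p * \<delta>\<bar> \<le> 1 * (2 * c)" "\<bar>q * k\<bar> \<le> 1 * 1"
      unfolding abs_mult using that d by (intro mult_mono; simp)+
    then have "\<bar>p * \<delta> + q * k\<bar> \<le> 2 * c + 1" by linarith
    then show ?thesis using D by auto
  qed
  have "i = (l * Z + x) * (D * v2) + (l * m + y) * (- D * v1) + D * ((- v2) * \<delta> + v1 * k)"
    by (simp add: i_def algebra_simps)
  with I shift[of "- v2" v1] uv have i: "i \<in> {- (2 * c + 1)..l + (2 * c + 1)}"
    by (auto simp: small_def)
  have "j = (l * Z + x) * (- D * u2) + (l * m + y) * (D * u1) + D * (u2 * \<delta> + (- u1) * k)"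
    by (simp add: j_def algebra_simps)
  with J shift[of u2 "- u1"] uv have j: "j \<in> {- (2 * c + 1)..l + (2 * c + 1)}"
    by (auto simp: small_def)
  have "u1 * i + v1 * j = D * D * (l * Z + x - \<delta>)"
    by (simp add: i_def j_def D_def algebra_simps)
  moreover have "u2 * i + v2 * j = D * D * (l * m + y - k)"
    by (simp add: i_def j_def D_def algebra_simps)
  ultimately have "(u1 + a * u2) * i + (v1 + a * v2) * j = l * Z + x - \<delta> + a * (l * m + y - k)"
    unfolding DD by (simp add: algebra_simps) (metis (no_types, opaque_lifting) distrib_left add.commute add.left_commute)
  moreover have "l * Z = l * X - l * P + k * (16 * l) + m * (7 * l)"
    by (simp add: Z_def algebra_simps)
  ultimately have "(l * X + x + a * y) - (l * P + (fst u + a * snd u) * i + (fst v + a * snd v) * j)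
      = \<delta> - k * (16 * l) - m * (7 * l + a * l) + a * k"
    by (simp add: algebra_simps)
  also have "\<dots> = n * (- m)"
    unfolding lattice(1,2) by (simp add: \<delta>_def algebra_simps)
  finally show ?thesis using i j by (metis dvd_triv_left)
qed

definition edge_points :: "int \<Rightarrow> int \<Rightarrow> int \<Rightarrow> ((int \<times> int) \<times> int) list \<Rightarrow> int set" where
  "edge_points l a w E = (\<Union>(u, P)\<in>set E. (\<lambda>i. l * P + (fst u + a * snd u) * i) ` {- w..l + w})"

lemma finite_edge_points: "finite (edge_points l a w E)"
  unfolding edge_points_def by (auto split: prod.splits)

lemma card_edge_points: "card (edge_points l a w E) \<le> length E * nat (l + 2 * w + 1)"
proof (induction E)
  case (Cons e E)
  obtain u P where e: "e = (u, P)" by (cases e)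
  let ?S = "(\<lambda>i. l * P + (fst u + a * snd u) * i) ` {- w..l + w}"
  have "card ?S \<le> card {- w..l + w}" by (rule card_image_le) simp
  also have "\<dots> = nat (l + 2 * w + 1)" by (simp add: algebra_simps)
  finally have S: "card ?S \<le> nat (l + 2 * w + 1)" .
  have "edge_points l a w (e # E) = ?S \<union> edge_points l a w E"
    by (simp add: edge_points_def e)
  then have "card (edge_points l a w (e # E)) \<le> card ?S + card (edge_points l a w E)"
    by (simp add: card_Un_le)
  with S Cons show ?case by simp
qed (simp add: edge_points_def)

lemma edge_pointsI:
  "(u, P) \<in> set E \<Longrightarrow> i \<in> {- w..l + w} \<Longrightarrow>
    l * P + (fst u + a * snd u) * i \<in> edge_points l a w E"
  unfolding edge_points_def by force

text \<open>
  \<open>\<alpha>\<close> and \<open>\<beta>\<close> measure by how much the two lattice vectors fail to vanish in \<open>\<int>/n\<close>: the vector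
  \<open>(16 l, 0)\<close> agrees with \<open>(\<alpha>, 1)\<close>, and \<open>(7 l, l)\<close> with \<open>(\<beta>, 0)\<close>.
\<close>

lemma difference_size_dihedral_torus:
  fixes l a \<alpha> \<beta> c :: int
  assumes n: "n > 0" and l: "l > 0" "7 * l \<le> a"
    and lattice: "16 * l = a + \<alpha>" "7 * l + a * l = int n + \<beta>"
    and c: "0 \<le> \<alpha>" "\<alpha> \<le> c" "0 \<le> \<beta>" "\<beta> \<le> c"
  shows "difference_size (dihedral_group n) \<le> 9 * nat (l + 4 * c + 3)"
proof -
  define w where "w = 2 * c + 1"
  define A where "A = edge_points l a w edges_A"
  define C where "C = edge_points l a w edges_C"
  have a: "a > 0" using l by simp
  \<comment> \<open>Division by \<open>a\<close> and then by \<open>l\<close> yields the digits.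
    Here \<open>7 * l \<le> a\<close> forces \<open>y \<le> l\<close>, and
    \<open>a \<le> 16 * l\<close> forces \<open>X \<le> 15\<close>.\<close>
  have point: "\<exists>X x y up. X \<in> set [0..15] \<and> 0 \<le> x \<and> x \<le> l \<and> 0 \<le> y \<and> y \<le> l \<and>
      (if up then x \<le> y else y \<le> x) \<and> z = l * X + x + a * y" if z: "0 \<le> z" "z < int n" for z
  proof -
    define y where "y = z div a"
    define X where "X = z mod a div l"
    define x where "x = z mod a mod l"
    have zeq: "z = l * X + x + a * y" by (simp add: X_def x_def y_def)
    have x: "0 \<le> x" "x \<le> l" using l by (auto simp: x_def order_less_imp_le)
    have y0: "0 \<le> y" using z a by (simp add: y_def pos_imp_zdiv_nonneg_iff)
    have X0: "0 \<le> X" using l a by (simp add: X_def pos_imp_zdiv_nonneg_iff)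
    have "y \<le> l"
    proof (rule ccontr)
      assume "\<not> y \<le> l"
      then have "a * (l + 1) \<le> a * y" using a by (intro mult_left_mono) auto
      moreover have "0 \<le> l * X" using l X0 by simp
      ultimately show False using zeq x z l lattice c by (simp add: algebra_simps)
    qed
    moreover have "X \<le> 15"
    proof (rule ccontr)
      assume "\<not> X \<le> 15"
      then have "l * 16 \<le> l * X" using l by (intro mult_left_mono) auto
      moreover have "l * X + x < a" using a by (simp add: X_def x_def)
      ultimately show False using x lattice c by simp
    qed
    ultimately show ?thesis using zeq x y0 X0
      by (intro exI[of _ X] exI[of _ x] exI[of _ y] exI[of _ "x \<le> y"]) auto
  qed
  have small_A: "\<forall>e\<in>set edges_A. small (fst e)"
    by (auto simp: edges_A_def small_def)
  have small_C: "\<forall>e\<in>set edges_C. small (fst e)"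
    by (auto simp: edges_C_def small_def)
  have abs: "\<bar>\<alpha>\<bar> \<le> c" "\<bar>\<beta>\<bar> \<le> c" using c by auto
  have modI: "s mod int n = z" if "int n dvd z - s" "0 \<le> z" "z < int n" for s z
    using that by (metis mod_eq_dvd_iff mod_pos_pos_trivial)
  have diff: "\<exists>p\<in>edge_points l a w E. \<exists>q\<in>edge_points l a w E. (p - q) mod int n = z"
    if cov: "diff_covers E up X" and sm: "\<forall>e\<in>set E. small (fst e)"
      and z: "0 \<le> z" "z < int n" "z = l * X + x + a * y"
      and xy: "0 \<le> x" "x \<le> l" "0 \<le> y" "y \<le> l" "if up then x \<le> y else y \<le> x"
    for E z up X x y
  proof -
    from cov obtain u P v1 v2 Q where uv: "(u, P) \<in> set E" "((v1, v2), Q) \<in> set E"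
      and cov: "covers up X u (- v1, - v2) (P - Q)"
      by (auto simp: diff_covers_def list_ex_iff)
    have "small u" "small (- v1, - v2)" using bspec[OF sm uv(1)] bspec[OF sm uv(2)] by (auto simp: small_def)
    from covers_point[OF cov this xy lattice abs, folded w_def]
    obtain i j where ij: "i \<in> {- w..l + w}" "j \<in> {- w..l + w}" and
      dvd: "int n dvd z - (l * (P - Q) + (fst u + a * snd u) * i + (- v1 + a * - v2) * j)"
      unfolding z(3) fst_conv snd_conv by blast
    have "l * (P - Q) + (fst u + a * snd u) * i + (- v1 + a * - v2) * j
        = (l * P + (fst u + a * snd u) * i) - (l * Q + (fst (v1, v2) + a * snd (v1, v2)) * j)"
      by (simp add: algebra_simps)
    with modI[OF dvd z(1,2)] edge_pointsI[OF uv(1) ij(1), of a] edge_pointsI[OF uv(2) ij(2), of a]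
    show ?thesis by metis
  qed
  have "difference_size (dihedral_group n) \<le> card A + card C"
  proof (rule difference_size_dihedral_le[OF n])
    show "finite A" "finite C" by (simp_all add: A_def C_def finite_edge_points)
  next
    fix z assume z: "0 \<le> z" "z < int n"
    from point[OF this] obtain X x y up where X: "X \<in> set [0..15]" and zeq: "z = l * X + x + a * y"
      and xy: "0 \<le> x" "x \<le> l" "0 \<le> y" "y \<le> l" "if up then x \<le> y else y \<le> x" by blast
    have "sum_covers edges_A edges_C up X"
      using sum_covers_edges X by (cases up) (simp_all add: list_all_iff del: set_upto)
    then obtain u P v Q where uv: "(u, P) \<in> set edges_A" "(v, Q) \<in> set edges_C"
      and cov: "covers up X u v (P + Q)"
      by (auto simp: sum_covers_def list_ex_iff)
    have "small u" "small v" using bspec[OF small_A uv(1)] bspec[OF small_C uv(2)] by simp_all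
    from covers_point[OF cov this xy lattice abs, folded w_def]
    obtain i j where ij: "i \<in> {- w..l + w}" "j \<in> {- w..l + w}" and
      dvd: "int n dvd z - (l * (P + Q) + (fst u + a * snd u) * i + (fst v + a * snd v) * j)"
      unfolding zeq by blast
    have "l * (P + Q) + (fst u + a * snd u) * i + (fst v + a * snd v) * j
        = (l * P + (fst u + a * snd u) * i) + (l * Q + (fst v + a * snd v) * j)"
      by (simp add: algebra_simps)
    with modI[OF dvd z] edge_pointsI[OF uv(1) ij(1), of a] edge_pointsI[OF uv(2) ij(2), of a]
    show "\<exists>a\<in>A. \<exists>c\<in>C. (a + c) mod int n = z"
      unfolding A_def C_def by metis
  next
    fix z assume z: "0 \<le> z" "2 * z \<le> int n"
    then have z': "z < int n" using n by linarith
    from point[OF z(1) z'] obtain X x y up where X: "X \<in> set [0..15]" and zeq: "z = l * X + x + a * y"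
      and xy: "0 \<le> x" "x \<le> l" "0 \<le> y" "y \<le> l" "if up then x \<le> y else y \<le> x" by blast
    consider "diff_covers edges_A up X" | "diff_covers edges_C up X"
      using diff_covers_edges X by (cases up) (auto simp: list_all_iff simp del: set_upto)
    then show "(\<exists>a\<in>A. \<exists>b\<in>A. (a - b) mod int n = z) \<or> (\<exists>a\<in>C. \<exists>b\<in>C. (a - b) mod int n = z)"
    proof cases
      case 1
      from diff[OF 1 small_A z(1) z' zeq xy] show ?thesis unfolding A_def by blast
    next
      case 2
      from diff[OF 2 small_C z(1) z' zeq xy] show ?thesis unfolding C_def by blast
    qed
  qed
  also have "card A \<le> 4 * nat (l + 2 * w + 1)"
    using card_edge_points[of l a w edges_A] by (simp add: A_def edges_A_def)
  also have "card C \<le> 5 * nat (l + 2 * w + 1)"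
    using card_edge_points[of l a w edges_C] by (simp add: C_def edges_C_def)
  finally show ?thesis by (simp add: w_def algebra_simps)
qed

section \<open>Choice of the torus parameters for large \<open>n\<close>\<close>

lemma difference_size_dihedral_large:
  assumes n: "n \<ge> 2 * 10 ^ 15"
  shows "3 * (difference_size (dihedral_group n))\<^sup>2 < 16 * n"
proof -
  \<comment> \<open>The ceiling of \<open>sqrt n / 4\<close>, the ideal unit length for a torus of
    area 16.\<close>
  define p where "p = (LEAST p. n \<le> 16 * p\<^sup>2)"
  have "n \<le> 16 * n\<^sup>2" by (simp add: power2_eq_square)
  then have p: "n \<le> 16 * p\<^sup>2" unfolding p_def by (rule LeastI)
  \<comment> \<open>\<open>16 * 11180000^2\<close> lies just below \<open>2 * 10^15\<close>.\<close>
  have p_large: "p \<ge> 11180000"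
  proof (rule ccontr)
    assume "\<not> ?thesis"
    then have "p\<^sup>2 \<le> 11180000\<^sup>2" by (intro power_mono) auto
    with p n show False by simp
  qed
  define q where "q = p - 1"
  have pq: "p = q + 1" using p_large by (simp add: q_def)
  have q: "16 * q\<^sup>2 < n"
    using not_less_Least[of q "\<lambda>p. n \<le> 16 * p\<^sup>2"] pq unfolding p_def by simp
  \<comment> \<open>The least \<open>b0\<close> with \<open>n \<le> b0 * p\<close>. Its excess
    \<open>\<beta>0\<close> may still be of order \<open>p\<close>, too much to absorb by prolonging
    segments.\<close>
  define b0 where "b0 = (n + p - 1) div p"
  define \<beta>0 where "\<beta>0 = b0 * p - n"
  have b0: "n \<le> b0 * p" "b0 * p < n + p"
  proof -
    have "b0 * p + (n + p - 1) mod p = n + p - 1" by (simp add: b0_def)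
    moreover have "(n + p - 1) mod p < p" using p_large by (intro mod_less_divisor) simp
    ultimately show "n \<le> b0 * p" "b0 * p < n + p" using p_large by linarith+
  qed
  have b0_le: "b0 \<le> 16 * p"
  proof (rule ccontr)
    assume "\<not> ?thesis"
    then have "(16 * p + 1) * p \<le> b0 * p" by (intro mult_right_mono) auto
    with b0 p show False by (simp add: power2_eq_square algebra_simps)
  qed
  have b0_ge: "16 * p \<le> b0 + 32"
  proof (rule ccontr)
    assume "\<not> ?thesis"
    then have "(b0 + 32) * p \<le> 16 * p * p" by (intro mult_right_mono) auto
    with b0 q have "16 * q\<^sup>2 + 32 * p < 16 * p * p" by (simp add: algebra_simps)
    then show False by (simp add: pq power2_eq_square algebra_simps)
  qed
  define e where "e = 16 * p - b0"
  have e: "b0 + e = 16 * p" "e \<le> 32" using b0_le b0_ge by (auto simp: e_def)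
  have \<beta>0: "n + \<beta>0 = b0 * p" "\<beta>0 < p" using b0 by (auto simp: \<beta>0_def)
  \<comment> \<open>The shift by \<open>t\<close> replaces \<open>p * b0\<close> by \<open>(p + t) * (b0 - 16 * t)\<close>, which exceeds \<open>n\<close> only by
    \<open>O(sqrt p)\<close>; here \<open>t = O(sqrt p)\<close>.\<close>
  define S where "S = {t. 16 * t\<^sup>2 + e * t \<le> \<beta>0}"
  have "S \<subseteq> {..\<beta>0}"
  proof
    fix t assume "t \<in> S"
    moreover have "t \<le> 16 * t\<^sup>2" by (simp add: power2_eq_square)
    ultimately have "t \<le> \<beta>0" unfolding S_def mem_Collect_eq by linarith
    then show "t \<in> {..\<beta>0}" by simp
  qed
  then have fin: "finite S" by (rule finite_subset) simp
  define t where "t = Max S"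
  have "0 \<in> S" by (simp add: S_def)
  with fin have "t \<in> S" unfolding t_def by (intro Max_in) auto
  then have t: "16 * t\<^sup>2 + e * t \<le> \<beta>0" by (simp add: S_def)
  have "t + 1 \<notin> S"
    using Max_ge[OF fin, of "t + 1"] by (auto simp: t_def)
  then have "\<not> 16 * (t + 1)\<^sup>2 + e * (t + 1) \<le> \<beta>0" by (simp add: S_def)
  \<comment> \<open>Passing from \<open>t\<close> to \<open>t + 1\<close> adds
    \<open>32 * t + 16 + e\<close>, where \<open>e \<le> 32\<close>.\<close>
  then have t': "\<beta>0 < 16 * t\<^sup>2 + e * t + 32 * t + 48"
    using e by (simp add: power2_eq_square algebra_simps)
  define l where "l = int (p + t)"
  \<comment> \<open>The 7 makes \<open>(a + 7) * l\<close> equal to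
    \<open>(b0 - 16 * t) * (p + t)\<close>, as the second lattice vector is
    \<open>(7 l, l)\<close>.\<close>
  define a where "a = int b0 - 16 * int t - 7"
  define c where "c = 32 * int t + 48"
  define \<alpha> where "\<alpha> = int e + 32 * int t + 7"
  define \<beta> where "\<beta> = int \<beta>0 - 16 * (int t)\<^sup>2 - int e * int t"
  \<comment> \<open>The tangent to the square at 836, about \<open>sqrt (p / 16)\<close> for the
    smallest \<open>p\<close>, turns \<open>16 * t^2 \<le> p\<close> into a linear bound on
    \<open>t\<close>.\<close>
  have t_small: "1672 * t \<le> t\<^sup>2 + 698896"
  proof -
    have "0 \<le> (int t - 836)\<^sup>2" by simp
    then have "int (1672 * t) \<le> int (t\<^sup>2 + 698896)" by (simp add: power2_eq_square algebra_simps)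
    then show ?thesis by linarith
  qed
  have tp: "16 * t\<^sup>2 \<le> p" using t \<beta>0 by linarith
  have main: "difference_size (dihedral_group n) \<le> 9 * nat (l + 4 * c + 3)"
  proof (rule difference_size_dihedral_torus)
    show "n > 0" using n by simp
    show "l > 0" using p_large by (simp add: l_def)
    have "7 * p + 23 * t + 7 \<le> b0"
      using e tp t_small p_large by linarith
    then have "int (7 * p + 23 * t + 7) \<le> int b0" by (rule of_nat_mono)
    then show "7 * l \<le> a" by (simp add: l_def a_def)
    show "16 * l = a + \<alpha>"
      unfolding l_def a_def \<alpha>_def using e by simp
    have eb: "int b0 = 16 * int p - int e" using e by linarith
    have nb: "int n = int b0 * int p - int \<beta>0" using \<beta>0 by (metis add_diff_cancel_right' of_nat_add of_nat_mult)
    show "7 * l + a * l = int n + \<beta>"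
      unfolding l_def a_def \<beta>_def nb eb by (simp add: power2_eq_square algebra_simps)
    show "0 \<le> \<alpha>" "\<alpha> \<le> c" using e by (simp_all add: \<alpha>_def c_def)
    have "int (16 * t\<^sup>2 + e * t) \<le> int \<beta>0" using t by (rule of_nat_mono)
    then show "0 \<le> \<beta>" by (simp add: \<beta>_def)
    have "int \<beta>0 < int (16 * t\<^sup>2 + e * t + 32 * t + 48)" using t' by (simp only: of_nat_less_iff)
    then show "\<beta> \<le> c" by (simp add: \<beta>_def c_def)
  qed
  have "nat (l + 4 * c + 3) = p + 129 * t + 195"
    by (simp add: l_def c_def)
  with main have size: "difference_size (dihedral_group n) \<le> 9 * (p + 129 * t + 195)" by simp
  \<comment> \<open>This allows the factor 9.23 in place of 9; it is small enough since
    \<open>3 * 923^2 < 256 * 10^4\<close>, while \<open>16 * n > 256 * q^2\<close>.\<close>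
  have "116100 * t + 176500 \<le> 23 * p"
    using tp t_small p_large by linarith
  with size pq have "100 * difference_size (dihedral_group n) \<le> 923 * q" by simp
  then have "(100 * difference_size (dihedral_group n))\<^sup>2 \<le> (923 * q)\<^sup>2"
    by (rule power_mono) simp
  then have "30000 * (difference_size (dihedral_group n))\<^sup>2 \<le> 3 * 851929 * q\<^sup>2"
    by (simp add: power_mult_distrib)
  with q show ?thesis by simp
qed

section \<open>The comb bound for every \<open>n\<close>\<close>

lemma difference_size_dihedral_small:
  assumes n: "n > 0"
  shows "293 * (difference_size (dihedral_group n))\<^sup>2 \<le> 2304 * n"
proof -
  let ?f = "\<lambda>n a. a + n div 2 div a + (n + a - 1) div a"
  have "\<exists>a>0. 293 * (?f n a)\<^sup>2 \<le> 2304 * n"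
  proof (cases "n < 80")
    case True
    \<comment> \<open>The step 11 is the ceiling of \<open>sqrt (3 * n / 2)\<close> at
      \<open>n = 79\<close>, the largest case checked here.\<close>
    have "list_all (\<lambda>n::int. list_ex (\<lambda>a. 293 * (a + n div 2 div a + (n + a - 1) div a)\<^sup>2 \<le> 2304 * n)
        [1..11]) [1..79]"
      by code_simp
    moreover have "int n \<in> set [1..79]" using True n by simp
    ultimately obtain b where b: "b \<in> set [1..11]"
      and f: "293 * (b + int n div 2 div b + (int n + b - 1) div b)\<^sup>2 \<le> 2304 * int n"
      unfolding list_all_iff list_ex_iff by blast
    define a where "a = nat b"
    have a: "b = int a" "a > 0" using b by (auto simp: a_def)
    have "int (?f n a) = b + int n div 2 div b + (int n + b - 1) div b"
      using a n by (simp add: zdiv_int)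
    with f have "int (293 * (?f n a)\<^sup>2) \<le> int (2304 * n)" by simp
    with a(2) show ?thesis by (intro exI[of _ a]) linarith
  next
    case False
    \<comment> \<open>The ceiling of \<open>sqrt (3 * n / 2)\<close> balances \<open>a\<close>
      against \<open>3 * n / (2 * a)\<close>.\<close>
    define a where "a = (LEAST a. 3 * n \<le> 2 * a\<^sup>2)"
    have "3 * n \<le> 2 * (2 * n)\<^sup>2" by (simp add: power2_eq_square)
    then have a: "3 * n \<le> 2 * a\<^sup>2" unfolding a_def by (rule LeastI)
    have a0: "a > 0" using a n by (cases a) auto
    have "\<not> 3 * n \<le> 2 * (a - 1)\<^sup>2"
      using not_less_Least[of "a - 1" "\<lambda>a. 3 * n \<le> 2 * a\<^sup>2"] a0 unfolding a_def by simp
    then obtain b where b: "a = b + 1" "2 * b\<^sup>2 < 3 * n" using a0 by (cases a) auto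
    have "?f n a \<le> 2 * a + 1"
    proof -
      have "a * (n div 2 div a) \<le> n div 2" "a * ((n + a - 1) div a) \<le> n + a - 1"
        by (rule times_div_less_eq_dividend)+
      then have "2 * (a * (n div 2 div a + (n + a - 1) div a)) \<le> 3 * n + 2 * a"
        unfolding distrib_left by linarith
      also have "\<dots> \<le> 2 * (a * (a + 1))" using a by (simp add: power2_eq_square algebra_simps)
      finally have "a * (n div 2 div a + (n + a - 1) div a) \<le> a * (a + 1)" by linarith
      then have "n div 2 div a + (n + a - 1) div a \<le> a + 1"
        using a0 by (rule mult_left_le_imp_le)
      then show ?thesis by simp
    qed
    then have "(?f n a)\<^sup>2 \<le> (2 * b + 3)\<^sup>2" using b by (intro power_mono) auto
    moreover have "293 * (2 * b + 3)\<^sup>2 \<le> 2304 * n"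
    \<comment> \<open>For small \<open>b\<close> the bound \<open>n \<ge> 80\<close> suffices;
      otherwise \<open>b \<le> b^2 / 11\<close> absorbs the linear term.\<close>
    proof (cases "b \<le> 10")
      case True
      then have "(2 * b + 3)\<^sup>2 \<le> 23\<^sup>2" by (intro power_mono) auto
      with False show ?thesis by simp
    next
      case False
      then have "11 * b \<le> b\<^sup>2" by (simp add: power2_eq_square)
      moreover have "293 * (2 * b + 3)\<^sup>2 = 1172 * b\<^sup>2 + 3516 * b + 2637"
        by (simp add: power2_eq_square algebra_simps)
      ultimately show ?thesis using b(2) \<open>\<not> n < 80\<close> by linarith
    qed
    ultimately show ?thesis using a0 by (intro exI[of _ a]) linarith
  qed
  then obtain a where "a > 0" and a: "293 * (?f n a)\<^sup>2 \<le> 2304 * n" by blast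
  have "(difference_size (dihedral_group n))\<^sup>2 \<le> (?f n a)\<^sup>2"
    by (intro power_mono difference_size_dihedral_comb n \<open>a > 0\<close>) simp
  with a show ?thesis by linarith
qed

section \<open>Translation into bounds on the difference characteristic\<close>

theorem theorem9:
  fixes n :: nat
  assumes "n > 0"
  shows "sqrt 2 \<le> difference_char (dihedral_group n)
       \<and> difference_char (dihedral_group n) \<le> 48 / sqrt 586
       \<and> (n \<ge> 2 * 10 ^ 15 \<longrightarrow> difference_char (dihedral_group n) < 4 / sqrt 6)"
proof -
  define D where "D = difference_size (dihedral_group n)"
  have "finite (carrier (dihedral_group n))" by (simp add: carrier_dihedral_group)
  from difference_size_attained[OF group_dihedral_group[OF assms] this]
  have lower: "4 * n \<le> D\<^sup>2"
    using dihedral_basis_card[OF assms] unfolding D_def by metis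
  have char: "difference_char (dihedral_group n) = sqrt ((real D)\<^sup>2 / real (2 * n))"
    by (simp add: difference_char_def order_dihedral_group D_def real_sqrt_divide)
  have "real (4 * n) \<le> real (D\<^sup>2)" using lower by (rule of_nat_mono)
  then have "2 \<le> (real D)\<^sup>2 / real (2 * n)"
    using assms by (simp add: field_simps)
  then have 1: "sqrt 2 \<le> difference_char (dihedral_group n)"
    unfolding char by (rule real_sqrt_le_mono)
  have "real (293 * D\<^sup>2) \<le> real (2304 * n)"
    using difference_size_dihedral_small[OF assms] unfolding D_def by (rule of_nat_mono)
  then have "(real D)\<^sup>2 / real (2 * n) \<le> 48\<^sup>2 / 586"
    using assms by (simp add: field_simps)
  then have "difference_char (dihedral_group n) \<le> sqrt (48\<^sup>2 / 586)"
    unfolding char by (rule real_sqrt_le_mono)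
  also have "\<dots> = 48 / sqrt 586" by (simp only: real_sqrt_divide) simp
  finally have 2: "difference_char (dihedral_group n) \<le> 48 / sqrt 586" .
  have "difference_char (dihedral_group n) < 4 / sqrt 6" if "n \<ge> 2 * 10 ^ 15"
  proof -
    have "real (3 * D\<^sup>2) < real (16 * n)"
      using difference_size_dihedral_large[OF that] unfolding D_def by (simp only: of_nat_less_iff)
    then have "(real D)\<^sup>2 / real (2 * n) < 4\<^sup>2 / 6"
      using assms by (simp add: field_simps)
    then have "difference_char (dihedral_group n) < sqrt (4\<^sup>2 / 6)"
      unfolding char by (rule real_sqrt_less_mono)
    also have "\<dots> = 4 / sqrt 6" by (simp only: real_sqrt_divide) simp
    finally show ?thesis .
  qed
  with 1 2 show ?thesis by blast
qed

end
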